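(* Let $d>1$ be an integer and let $\sigma>0$ with $\sigma d>2$. Let $\psi(t,r)$, $0\le t<T_c<\infty$, be a radially-symmetric singular solution of the nonlinear Schr\"odinger equation $$i\psi_t(t,r)+\psi_{rr}+\frac{d-1}{r}\psi_r+|\psi|^{2\sigma}\psi=0,\qquad \psi(0,r)=\psi_0(r),$$ that becomes singular at time $T_c$. Suppose that $\psi$ is a standing-ring solution, i.e., $\psi\sim\psi_F$ as $t\to T_c$ in the region $|r-r_{\max}(t)|\le\rho_c L(t)$, for some constant $\rho_c>0$, where $$|\psi_F(t,r)|=\frac{1}{L^{1/\sigma}(t)}|F(\rho)|,\qquad \rho=\frac{r-r_{\max}(t)}{L(t)},\qquad \lim_{t\to T_c}L(t)=0,$$ and $$0<\lim_{t\to T_c}r_{\max}(t)<\infty .$$ Then $\sigma\ge 2$.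
   Context: Here $r=|\mathbf{x}|$, $\mathbf{x}\in\mathbb{R}^d$. The solution has finite power, $\psi_0\in L^2(\mathbb{R}^d)$, and the power is conserved: $\|\psi(t)\|_2=\|\psi_0\|_2$ for $0\le t<T_c$, where for radial functions $\|f\|_2^2$ is (up to the constant surface area of the unit sphere) $\int_0^\infty |f|^2r^{d-1}\,dr$. Singular at $T_c$ means $\lim_{t\to T_c}\|\psi(t)\|_{H^1}=\infty$. The function $L(t)>0$ is the ring width and $r_{\max}(t)=\arg\max_r|\psi(t,r)|$ is the ring radius. The profile $F$ is a continuous, not identically zero function on $[-\rho_c,\rho_c]$ that does not depend on $t$. The relation $\psi\sim\psi_F$ in the ring region means, for the moduli, that $L^{1/\sigma}(t)\,|\psi(t,r_{\max}(t)+L(t)\rho)|\to|F(\rho)|$ as $t\to T_c$, uniformly for $|\rho|\le\rho_c$. *)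

theory Defs
  imports "HOL-Analysis.Analysis"
begin

text \<open>
  A radial function on \<open>d\<close>-dimensional Euclidean space is represented by its profile
  \<open>f :: real \<Rightarrow> complex\<close>, of which only the values at \<open>r \<ge> 0\<close> matter. Integrals over the
  space are written in polar coordinates; \<open>d * unit_ball_vol d\<close> is the surface area of the
  unit sphere.
\<close>

definition radial_L2 :: "nat \<Rightarrow> (real \<Rightarrow> complex) \<Rightarrow> bool" where
  "radial_L2 d f \<longleftrightarrow>
     set_borel_measurable lborel {0<..} f \<and>
     set_integrable lborel {0<..} (\<lambda>r. (cmod (f r))\<^sup>2 * r ^ (d - 1))"

definition radial_L2_norm :: "nat \<Rightarrow> (real \<Rightarrow> complex) \<Rightarrow> real" where
  "radial_L2_norm d f =
     sqrt (real d * unit_ball_vol (real d) *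
           (LINT r:{0<..}|lborel. (cmod (f r))\<^sup>2 * r ^ (d - 1)))"

text \<open>
  The gradient of \<open>f (norm x)\<close> has modulus \<open>cmod (f' r)\<close> at \<open>r = norm x\<close>. Only profiles that are
  differentiable away from the origin occur below, so the classical derivative is used for
  membership in \<open>H\<^sup>1\<close> and for its norm; the origin is negligible when \<open>d > 1\<close>.
\<close>

definition radial_H1 :: "nat \<Rightarrow> (real \<Rightarrow> complex) \<Rightarrow> bool" where
  "radial_H1 d f \<longleftrightarrow>
     (\<forall>r>0. f differentiable (at r)) \<and>
     radial_L2 d f \<and> radial_L2 d (\<lambda>r. vector_derivative f (at r))"

definition radial_H1_norm :: "nat \<Rightarrow> (real \<Rightarrow> complex) \<Rightarrow> real" where
  "radial_H1_norm d f =
     sqrt ((radial_L2_norm d f)\<^sup>2 + (radial_L2_norm d (\<lambda>r. vector_derivative f (at r)))\<^sup>2)"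

text \<open>
  Classical solutions on \<open>0 \<le> t < T\<close> with values in \<open>H\<^sup>1\<close>. The time derivative at
  \<open>t = 0\<close> is one-sided. The equation is imposed for \<open>r > 0\<close>, where the coefficient
  \<open>(d - 1) / r\<close> makes sense.
\<close>

definition radial_nls_solution ::
  "nat \<Rightarrow> real \<Rightarrow> real \<Rightarrow> (real \<Rightarrow> complex) \<Rightarrow> (real \<Rightarrow> real \<Rightarrow> complex) \<Rightarrow> bool" where
  "radial_nls_solution d \<sigma> T \<psi>\<^sub>0 \<psi> \<longleftrightarrow>
     (\<forall>r\<ge>0. \<psi> 0 r = \<psi>\<^sub>0 r) \<and>
     (\<forall>t\<in>{0..<T}. continuous_on {0..} (\<psi> t) \<and> radial_H1 d (\<psi> t)) \<and>
     (\<forall>t\<in>{0..<T}. \<forall>r>0.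
        (\<lambda>s. \<psi> s r) differentiable (at t within {0..<T}) \<and>
        (\<lambda>y. vector_derivative (\<psi> t) (at y)) differentiable (at r) \<and>
        \<i> * vector_derivative (\<lambda>s. \<psi> s r) (at t within {0..<T})
          + vector_derivative (\<lambda>y. vector_derivative (\<psi> t) (at y)) (at r)
          + complex_of_real ((real d - 1) / r) * vector_derivative (\<psi> t) (at r)
          + complex_of_real (cmod (\<psi> t r) powr (2 * \<sigma>)) * \<psi> t r = 0)"

definition becomes_singular_at :: "nat \<Rightarrow> real \<Rightarrow> (real \<Rightarrow> real \<Rightarrow> complex) \<Rightarrow> bool" where
  "becomes_singular_at d T \<psi> \<longleftrightarrow>
     filterlim (\<lambda>t. radial_H1_norm d (\<psi> t)) at_top (at_left T)"

text \<open>
  \<open>\<psi> \<sim> \<psi>\<^sub>F\<close> for the moduli, in the region \<open>\<bar>r - r\<^sub>m t\<bar> \<le> \<rho>\<^sub>c * L t\<close>, where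
  \<open>cmod (\<psi>\<^sub>F t r) = L t powr (- 1 / \<sigma>) * cmod (F \<rho>)\<close> with \<open>r = r\<^sub>m t + L t * \<rho>\<close>.
\<close>

definition ring_asymptotic ::
  "real \<Rightarrow> real \<Rightarrow> (real \<Rightarrow> real \<Rightarrow> complex) \<Rightarrow> (real \<Rightarrow> complex) \<Rightarrow> real \<Rightarrow>
   (real \<Rightarrow> real) \<Rightarrow> (real \<Rightarrow> real) \<Rightarrow> bool" where
  "ring_asymptotic \<sigma> T \<psi> F \<rho>\<^sub>c L r\<^sub>m \<longleftrightarrow>
     uniform_limit {-\<rho>\<^sub>c..\<rho>\<^sub>c}
       (\<lambda>t \<rho>. L t powr (1 / \<sigma>) * cmod (\<psi> t (r\<^sub>m t + L t * \<rho>)))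
       (\<lambda>\<rho>. cmod (F \<rho>)) (at_left T)"

end

theory Submission
  imports Defs
begin

text \<open>
  On a fixed \<open>\<rho>\<close>-interval where \<open>F\<close> stays away from zero, the ring carries amplitude of order
  \<open>L powr (- 1 / \<sigma>)\<close> over a set of radii of length of order \<open>L\<close>. Because the ring radius
  stays away from the origin, the polar weight \<open>r ^ (d - 1)\<close> is bounded below there, so the
  region holds power at least of order \<open>L powr (1 - 2 / \<sigma>)\<close>. The total power is conserved,
  hence finite uniformly in \<open>t\<close>, while \<open>L\<close> tends to zero; this forces \<open>1 - 2 / \<sigma> \<ge> 0\<close>.
  The interval is provided by \<open>continuous_nonzero_bounded_below_on_subinterval\<close> and the lower
  bound for the power by \<open>radial_L2_norm_lower_bound\<close>.
\<close>

text \<open>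
  A point where \<open>f\<close> does not vanish may be an end point of the interval. A function that
  vanishes on the open interval also vanishes on its closure, so there is such a point in
  the interior as well, and it has a neighbourhood on which \<open>norm (f x)\<close> is more than half
  its value at the point.
\<close>

lemma continuous_nonzero_bounded_below_on_subinterval:
  fixes f :: "real \<Rightarrow> 'a::real_normed_vector"
  assumes cont: "continuous_on {a..b} f" and "a < b" and nz: "\<exists>x\<in>{a..b}. f x \<noteq> 0"
  obtains u v c where "a \<le> u" "u < v" "v \<le> b" "c > 0" "\<And>x. x \<in> {u..v} \<Longrightarrow> c \<le> norm (f x)"
proof -
  have "\<exists>x\<in>{a<..<b}. f x \<noteq> 0"
  proof (rule ccontr)
    assume "\<not> ?thesis"
    moreover have "closure {a<..<b} = {a..b}"
      using \<open>a < b\<close> by simp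
    ultimately have "f x = 0" if "x \<in> {a..b}" for x
      using continuous_constant_on_closure[of "{a<..<b}" f 0 x] cont that by auto
    with nz show False by blast
  qed
  then obtain x0 where x0: "x0 \<in> {a<..<b}" "f x0 \<noteq> 0" by blast
  define c where "c = norm (f x0) / 2"
  have "open ({a<..<b} \<inter> (\<lambda>x. norm (f x)) -` {c<..})"
    by (intro continuous_open_preimage continuous_on_norm continuous_on_subset[OF cont]) auto
  moreover have "x0 \<in> {a<..<b} \<inter> (\<lambda>x. norm (f x)) -` {c<..}"
    using x0 by (simp add: c_def)
  ultimately obtain e where e: "e > 0"
    "cball x0 e \<subseteq> {a<..<b} \<inter> (\<lambda>x. norm (f x)) -` {c<..}"
    by (meson open_contains_cball)
  have near: "x \<in> {a<..<b} \<and> c < norm (f x)" if "x \<in> {x0 - e..x0 + e}" for x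
    using e(2) that by (auto simp: cball_eq_atLeastAtMost)
  show thesis
  proof
    show "a \<le> x0 - e" "x0 + e \<le> b" "x0 - e < x0 + e"
      using near[of "x0 - e"] near[of "x0 + e"] e(1) by auto
    show "c > 0" using x0 by (simp add: c_def)
    show "c \<le> norm (f x)" if "x \<in> {x0 - e..x0 + e}" for x
      using near[OF that] by simp
  qed
qed

text \<open>
  The radius \<open>s\<close> is separate from the inner radius \<open>p\<close> so that, for a shell moving with time
  but staying outside a fixed ball, the bound depends on the shell only through its width
  and the amplitude \<open>m\<close>.
\<close>

lemma radial_L2_norm_lower_bound:
  assumes L2: "radial_L2 d f" and "0 < s" "s \<le> p" "p \<le> q" and "0 \<le> m"
    and m: "\<And>r. r \<in> {p..q} \<Longrightarrow> m \<le> cmod (f r)"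
  shows "real d * unit_ball_vol (real d) * (m\<^sup>2 * s ^ (d - 1) * (q - p)) \<le> (radial_L2_norm d f)\<^sup>2"
proof -
  let ?g = "\<lambda>r. (cmod (f r))\<^sup>2 * r ^ (d - 1)"
  let ?I = "LINT r:{0<..}|lborel. ?g r"
  have int: "set_integrable lborel {0<..} ?g"
    using L2 by (simp add: radial_L2_def)
  have sub: "{p..q} \<subseteq> {0<..}"
    using \<open>0 < s\<close> \<open>s \<le> p\<close> by auto
  have "m\<^sup>2 * s ^ (d - 1) * (q - p) = (LINT r:{p..q}|lborel. m\<^sup>2 * s ^ (d - 1))"
    using \<open>p \<le> q\<close> by (simp add: set_lebesgue_integral_def)
  also have "\<dots> \<le> (LINT r:{p..q}|lborel. ?g r)"
  proof (rule set_integral_mono)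
    show "set_integrable lborel {p..q} (\<lambda>r. m\<^sup>2 * s ^ (d - 1))"
      by (intro borel_integrable_atLeastAtMost' continuous_on_const)
    show "set_integrable lborel {p..q} ?g"
      by (rule set_integrable_subset[OF int _ sub]) simp
    show "m\<^sup>2 * s ^ (d - 1) \<le> ?g r" if "r \<in> {p..q}" for r
      using m[OF that] that \<open>0 \<le> m\<close> \<open>0 < s\<close> \<open>s \<le> p\<close> by (intro mult_mono power_mono) auto
  qed
  also have "\<dots> \<le> ?I"
    unfolding set_lebesgue_integral_def
  proof (rule integral_mono)
    show "integrable lborel (\<lambda>r. indicat_real {p..q} r *\<^sub>R ?g r)"
      using set_integrable_subset[OF int _ sub] by (simp add: set_integrable_def)
    show "integrable lborel (\<lambda>r. indicat_real {0<..} r *\<^sub>R ?g r)"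
      using int by (simp add: set_integrable_def)
    show "indicat_real {p..q} r *\<^sub>R ?g r \<le> indicat_real {0<..} r *\<^sub>R ?g r" for r
      using sub by (auto simp: indicator_def)
  qed
  finally have le: "m\<^sup>2 * s ^ (d - 1) * (q - p) \<le> ?I" .
  moreover have "0 \<le> m\<^sup>2 * s ^ (d - 1) * (q - p)"
    using \<open>0 < s\<close> \<open>p \<le> q\<close> by simp
  ultimately have "(radial_L2_norm d f)\<^sup>2 = real d * unit_ball_vol (real d) * ?I"
    by (simp add: radial_L2_norm_def)
  with le show ?thesis
    by (simp add: mult_left_mono)
qed

theorem lemma1:
  fixes d :: nat and \<sigma> T\<^sub>c \<rho>\<^sub>c R :: real
    and \<psi> :: "real \<Rightarrow> real \<Rightarrow> complex" and \<psi>\<^sub>0 F :: "real \<Rightarrow> complex"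
    and L r\<^sub>m\<^sub>a\<^sub>x :: "real \<Rightarrow> real"
  assumes "d > 1" and "\<sigma> > 0" and "\<sigma> * real d > 2" and "T\<^sub>c > 0"
    and "radial_L2 d \<psi>\<^sub>0"
    and "radial_nls_solution d \<sigma> T\<^sub>c \<psi>\<^sub>0 \<psi>"
    and "\<And>t. t \<in> {0..<T\<^sub>c} \<Longrightarrow> radial_L2_norm d (\<psi> t) = radial_L2_norm d \<psi>\<^sub>0"
    and "becomes_singular_at d T\<^sub>c \<psi>"
    and "\<And>t. t \<in> {0..<T\<^sub>c} \<Longrightarrow> L t > 0"
    and "\<And>t. t \<in> {0..<T\<^sub>c} \<Longrightarrow> is_arg_max (\<lambda>r. cmod (\<psi> t r)) (\<lambda>r. r \<ge> 0) (r\<^sub>m\<^sub>a\<^sub>x t)"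
    and "\<rho>\<^sub>c > 0"
    and "continuous_on {-\<rho>\<^sub>c..\<rho>\<^sub>c} F" and "\<exists>\<rho>\<in>{-\<rho>\<^sub>c..\<rho>\<^sub>c}. F \<rho> \<noteq> 0"
    and "ring_asymptotic \<sigma> T\<^sub>c \<psi> F \<rho>\<^sub>c L r\<^sub>m\<^sub>a\<^sub>x"
    and "(L \<longlongrightarrow> 0) (at_left T\<^sub>c)"
    and "(r\<^sub>m\<^sub>a\<^sub>x \<longlongrightarrow> R) (at_left T\<^sub>c)" and "0 < R"
  shows "\<sigma> \<ge> 2"
proof (rule ccontr)
  assume "\<not> \<sigma> \<ge> 2"
  then have "2 / \<sigma> - 1 > 0"
    using \<open>\<sigma> > 0\<close> by (simp add: field_simps)
  have H1: "radial_L2 d (\<psi> t)" if "t \<in> {0..<T\<^sub>c}" for t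
    using assms(6) that by (auto simp: radial_nls_solution_def radial_H1_def)
  obtain u v c where uv: "- \<rho>\<^sub>c \<le> u" "u < v" "v \<le> \<rho>\<^sub>c" and "c > 0"
    and c: "\<And>\<rho>. \<rho> \<in> {u..v} \<Longrightarrow> c \<le> cmod (F \<rho>)"
    by (rule continuous_nonzero_bounded_below_on_subinterval[OF assms(12) _ assms(13)])
      (use \<open>\<rho>\<^sub>c > 0\<close> in auto)
  define K where "K = real d * unit_ball_vol (real d) * ((c / 2)\<^sup>2 * (R / 2) ^ (d - 1) * (v - u))"
  define N where "N = (radial_L2_norm d \<psi>\<^sub>0)\<^sup>2"
  have "K > 0"
    using \<open>d > 1\<close> \<open>c > 0\<close> \<open>0 < R\<close> uv by (simp add: K_def)
  have time: "\<forall>\<^sub>F t in at_left T\<^sub>c. t \<in> {0..<T\<^sub>c}"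
    using eventually_at_left_real[OF \<open>T\<^sub>c > 0\<close>] by eventually_elim auto
  have profile: "\<forall>\<^sub>F t in at_left T\<^sub>c. \<forall>\<rho>\<in>{-\<rho>\<^sub>c..\<rho>\<^sub>c}.
      dist (L t powr (1 / \<sigma>) * cmod (\<psi> t (r\<^sub>m\<^sub>a\<^sub>x t + L t * \<rho>))) (cmod (F \<rho>)) < c / 2"
    using assms(14) half_gt_zero[OF \<open>c > 0\<close>] unfolding ring_asymptotic_def uniform_limit_iff
    by blast
  have "((\<lambda>t. r\<^sub>m\<^sub>a\<^sub>x t + L t * u) \<longlongrightarrow> R + 0 * u) (at_left T\<^sub>c)"
    by (intro tendsto_intros assms)
  then have away: "\<forall>\<^sub>F t in at_left T\<^sub>c. R / 2 < r\<^sub>m\<^sub>a\<^sub>x t + L t * u"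
    by (rule order_tendstoD) (use \<open>0 < R\<close> in simp)
  \<comment> \<open>The power bound \<open>K * L t powr (1 - 2 / \<sigma>) \<le> N\<close>, multiplied by a power of \<open>L t\<close> that
    tends to zero when \<open>\<sigma> < 2\<close>, so that it contradicts \<open>K > 0\<close> in the limit.\<close>
  have "\<forall>\<^sub>F t in at_left T\<^sub>c. K \<le> N * L t powr (2 / \<sigma> - 1)"
    using time profile away
  proof eventually_elim
    case (elim t)
    have L: "L t > 0" using assms(9) elim by blast
    define m where "m = c / 2 * L t powr (- 1 / \<sigma>)"
    have amplitude: "m \<le> cmod (\<psi> t r)"
      if "r \<in> {r\<^sub>m\<^sub>a\<^sub>x t + L t * u..r\<^sub>m\<^sub>a\<^sub>x t + L t * v}" for r
    proof -
      define \<rho> where "\<rho> = (r - r\<^sub>m\<^sub>a\<^sub>x t) / L t"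
      have r: "r = r\<^sub>m\<^sub>a\<^sub>x t + L t * \<rho>" using L by (simp add: \<rho>_def)
      have \<rho>: "\<rho> \<in> {u..v}" using that L by (simp add: r)
      then have "\<rho> \<in> {-\<rho>\<^sub>c..\<rho>\<^sub>c}" using uv by simp
      with elim(2) have "dist (L t powr (1 / \<sigma>) * cmod (\<psi> t r)) (cmod (F \<rho>)) < c / 2"
        unfolding r by blast
      with c[OF \<rho>] have "c / 2 \<le> L t powr (1 / \<sigma>) * cmod (\<psi> t r)"
        unfolding dist_real_def by linarith
      then show ?thesis
        using L by (simp add: m_def powr_minus field_simps)
    qed
    have "real d * unit_ball_vol (real d) * (m\<^sup>2 * (R / 2) ^ (d - 1) *
        (r\<^sub>m\<^sub>a\<^sub>x t + L t * v - (r\<^sub>m\<^sub>a\<^sub>x t + L t * u))) \<le> (radial_L2_norm d (\<psi> t))\<^sup>2"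
      by (rule radial_L2_norm_lower_bound[OF H1[OF elim(1)] _ _ _ _ amplitude])
        (use \<open>0 < R\<close> \<open>c > 0\<close> elim L uv in \<open>auto simp: m_def\<close>)
    also have "\<dots> = N" using assms(7)[OF elim(1)] by (simp add: N_def)
    also have "m\<^sup>2 = (c / 2)\<^sup>2 * L t powr (- 2 / \<sigma>)"
      unfolding m_def power_mult_distrib by (simp add: power2_eq_square flip: powr_add)
    finally have "K * (L t powr (- 2 / \<sigma>) * L t) \<le> N"
      by (simp add: K_def algebra_simps)
    then have "K * (L t powr (- 2 / \<sigma>) * L t) * L t powr (2 / \<sigma> - 1) \<le> N * L t powr (2 / \<sigma> - 1)"
      by (rule mult_right_mono) simp
    moreover have "L t powr (- 2 / \<sigma>) * L t * L t powr (2 / \<sigma> - 1) = 1"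
      using L by (simp add: powr_diff powr_minus field_simps)
    ultimately show ?case by (simp add: mult.assoc)
  qed
  moreover have "((\<lambda>t. N * L t powr (2 / \<sigma> - 1)) \<longlongrightarrow> N * 0) (at_left T\<^sub>c)"
  proof (intro tendsto_mult tendsto_const)
    show "((\<lambda>t. L t powr (2 / \<sigma> - 1)) \<longlongrightarrow> 0) (at_left T\<^sub>c)"
      by (rule tendsto_zero_powrI[OF assms(15) tendsto_const _ \<open>2 / \<sigma> - 1 > 0\<close>])
        (use time assms(9) in \<open>auto elim!: eventually_mono intro: less_imp_le\<close>)
  qed
  ultimately have "K \<le> N * 0"
    by (intro tendsto_lowerbound) auto
  with \<open>K > 0\<close> show False by simp
qed

end
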